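(* For any even $q\geq 2$ and any integer $\gamma$ with $\frac{q}{2}<\gamma<q$, there is a completely regular code in $H(3,q)$ with covering radius $1$, eigenvalue $\lambda_2(3,q)$ and parameter $\gamma$.
   Context: Let $\mathcal{A}$ be a set of size $q$; $H(3,q)$ has vertex set $\mathcal{A}^3$, tuples adjacent iff they differ in exactly one position; $\lambda_2(3,q)=q-3$. A set $C$ of vertices is a completely regular code with covering radius $1$ if $C$ is a nonempty proper subset and there are integers $\beta,\gamma\geq1$ such that every vertex of $C$ has exactly $\beta$ neighbours outside $C$ and every vertex outside $C$ has exactly $\gamma$ neighbours in $C$; it has eigenvalue $\lambda_2(3,q)$ iff $3(q-1)-(\beta+\gamma)=q-3$, i.e. $\beta+\gamma=2q$. *)

theory Defs
  imports Complex_Main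
begin

text \<open>The Hamming graph \<open>H(n, q)\<close> over an alphabet \<open>A\<close> with \<open>card A = q\<close>; its vertices, the
  \<open>n\<close>-tuples over \<open>A\<close>, are the lists of length \<open>n\<close> with entries in \<open>A\<close>.\<close>

definition hamming_verts :: "nat \<Rightarrow> 'a set \<Rightarrow> 'a list set" where
  "hamming_verts n A = {x. length x = n \<and> set x \<subseteq> A}"

definition hamming_adj :: "nat \<Rightarrow> 'a list \<Rightarrow> 'a list \<Rightarrow> bool" where
  "hamming_adj n x y \<longleftrightarrow> (\<exists>!i. i < n \<and> x ! i \<noteq> y ! i)"

definition hamming_degree :: "nat \<Rightarrow> nat \<Rightarrow> int" where
  "hamming_degree n q = int n * (int q - 1)"

definition hamming_eigenvalue :: "nat \<Rightarrow> nat \<Rightarrow> nat \<Rightarrow> int" where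
  "hamming_eigenvalue i n q = hamming_degree n q - int i * int q"

lemma hamming_eigenvalue_2_3: "hamming_eigenvalue 2 3 q = int q - 3"
  by (simp add: hamming_eigenvalue_def hamming_degree_def algebra_simps)

text \<open>Completely regular codes of covering radius 1, with parameters \<open>\<beta>\<close> and \<open>\<gamma>\<close>, in the graph
  with vertex set \<open>V\<close> and adjacency relation \<open>adj\<close>.\<close>

definition completely_regular_code_1 ::
    "'v set \<Rightarrow> ('v \<Rightarrow> 'v \<Rightarrow> bool) \<Rightarrow> 'v set \<Rightarrow> nat \<Rightarrow> nat \<Rightarrow> bool" where
  "completely_regular_code_1 V adj C \<beta> \<gamma> \<longleftrightarrow>
     C \<noteq> {} \<and> C \<subset> V \<and> \<beta> \<ge> 1 \<and> \<gamma> \<ge> 1 \<and>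
     (\<forall>x\<in>C. card {y \<in> V - C. adj x y} = \<beta>) \<and>
     (\<forall>x\<in>V - C. card {y \<in> C. adj x y} = \<gamma>)"

text \<open>In a \<open>k\<close>-regular graph, the quotient matrix of such a code has rows \<open>(k - \<beta>, \<beta>)\<close> and
  \<open>(\<gamma>, k - \<gamma>)\<close>. The eigenvalue of the code is the eigenvalue of this matrix other than \<open>k\<close>.\<close>

definition code_eigenvalue :: "int \<Rightarrow> nat \<Rightarrow> nat \<Rightarrow> int" where
  "code_eigenvalue k \<beta> \<gamma> = k - (int \<beta> + int \<gamma>)"

lemma quotient_matrix_charpoly:
  fixes t k :: int
  shows "(k - int \<beta> - t) * (k - int \<gamma> - t) - int \<beta> * int \<gamma>
           = (t - k) * (t - code_eigenvalue k \<beta> \<gamma>)"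
  by (simp add: code_eigenvalue_def algebra_simps)

end

theory Submission
  imports Defs "HOL-Number_Theory.Cong"
begin

text \<open>Since the eigenvalue condition reads \<open>\<beta> + \<gamma> = 2q\<close>, a set \<open>C\<close> is a code as required iff, for
  every vertex \<open>v\<close>, the numbers of elements of \<open>C\<close> on the three lines through \<open>v\<close> add up to
  \<open>\<gamma> + q\<close> if \<open>v \<in> C\<close> and to \<open>\<gamma>\<close> otherwise. Take \<open>X, B \<subseteq> A\<close> with \<open>|X| = \<gamma>\<close> and \<open>|B| = q / 2\<close>, and
  a \<open>(\<gamma> - q / 2)\<close>-regular bipartite graph \<open>E \<subseteq> X \<times> X\<close>. Let \<open>C\<close> consist of the triples
  \<open>(s, x, y)\<close> such that \<open>(x, y) \<in> E\<close>, or \<open>s \<in> B\<close> and \<open>(x, y) \<in> (A - X) \<times> X\<close>, or \<open>s \<in> A - B\<close> and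
  \<open>(x, y) \<in> X \<times> (A - X)\<close>. The line sums are then checked region by region.\<close>

lemma hamming_adj_3_iff:
  "hamming_adj 3 [s, x, y] [a, b, c] \<longleftrightarrow>
     (a \<noteq> s \<and> b = x \<and> c = y) \<or> (a = s \<and> b \<noteq> x \<and> c = y) \<or> (a = s \<and> b = x \<and> c \<noteq> y)"
proof -
  \<comment> \<open>Bounded quantifiers let simplification run through the positions 0, 1,
    2.\<close>
  have "hamming_adj 3 [s, x, y] [a, b, c] \<longleftrightarrow>
      (\<exists>i<3. [s, x, y] ! i \<noteq> [a, b, c] ! i \<and>
        (\<forall>j<3. [s, x, y] ! j \<noteq> [a, b, c] ! j \<longrightarrow> j = i))"
    unfolding hamming_adj_def by blast
  also have "\<dots> \<longleftrightarrow> (a \<noteq> s \<and> b = x \<and> c = y) \<or> (a = s \<and> b \<noteq> x \<and> c = y) \<or> (a = s \<and> b = x \<and> c \<noteq> y)"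
    by (simp add: numeral_3_eq_3 Ex_less_Suc All_less_Suc) blast
  finally show ?thesis .
qed

lemma hamming_verts_3_iff:
  "v \<in> hamming_verts 3 A \<longleftrightarrow> (\<exists>a\<in>A. \<exists>b\<in>A. \<exists>c\<in>A. v = [a, b, c])"
  by (auto simp: hamming_verts_def numeral_3_eq_3 length_Suc_conv)

text \<open>Two lines through \<open>[s, x, y]\<close> meet only in that vertex, which fails
  \<open>P\<close>; so the triples with \<open>P\<close> on the three lines are distinct and all are
  neighbours. Used with \<open>P\<close> for vertices outside the code and with its negation for
  vertices inside.\<close>

lemma card_neighbours_3:
  assumes "finite A" "s \<in> A" "x \<in> A" "y \<in> A" "\<not> P s x y"
  shows "card {v. (\<exists>a\<in>A. \<exists>b\<in>A. \<exists>c\<in>A. v = [a, b, c] \<and> P a b c) \<and> hamming_adj 3 [s, x, y] v}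
    = card {a\<in>A. P a x y} + card {b\<in>A. P s b y} + card {c\<in>A. P s x c}"
    (is "card ?N = card ?L1 + card ?L2 + card ?L3")
proof -
  let ?f1 = "\<lambda>a. [a, x, y]" and ?f2 = "\<lambda>b. [s, b, y]" and ?f3 = "\<lambda>c. [s, x, c]"
  have N: "?N = (?f1 ` ?L1 \<union> ?f2 ` ?L2) \<union> ?f3 ` ?L3"
    using assms by (auto simp: hamming_adj_3_iff)
  have "(?f1 ` ?L1 \<union> ?f2 ` ?L2) \<inter> ?f3 ` ?L3 = {}" "?f1 ` ?L1 \<inter> ?f2 ` ?L2 = {}"
    using assms(5) by auto
  moreover have "card (?f1 ` ?L1) = card ?L1" "card (?f2 ` ?L2) = card ?L2"
      "card (?f3 ` ?L3) = card ?L3"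
    by (auto intro!: card_image inj_onI)
  ultimately show ?thesis
    unfolding N using assms(1) by (simp add: card_Un_disjoint)
qed

text \<open>Outside \<open>C\<close> the line sum is the number of neighbours in \<open>C\<close>.
  Inside, complementing on each of the three lines leaves 3q - (q + \<gamma>) = 2q - \<gamma>
  neighbours outside \<open>C\<close>, where q = \<open>card A\<close>.\<close>

lemma completely_regular_code_1_by_line_sums:
  fixes P :: "'a \<Rightarrow> 'a \<Rightarrow> 'a \<Rightarrow> bool" and A :: "'a set"
  defines "C \<equiv> {v. \<exists>a\<in>A. \<exists>b\<in>A. \<exists>c\<in>A. v = [a, b, c] \<and> P a b c}"
  assumes fin: "finite A" and "0 < \<gamma>" "\<gamma> < 2 * card A"
    and "C \<noteq> {}" "C \<noteq> hamming_verts 3 A"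
    and sums: "\<And>s x y. s \<in> A \<Longrightarrow> x \<in> A \<Longrightarrow> y \<in> A \<Longrightarrow>
      card {a\<in>A. P a x y} + card {b\<in>A. P s b y} + card {c\<in>A. P s x c}
        = (if P s x y then card A else 0) + \<gamma>"
  shows "completely_regular_code_1 (hamming_verts 3 A) (hamming_adj 3) C (2 * card A - \<gamma>) \<gamma>"
proof -
  have not_card: "card {a\<in>A. \<not> Q a} + card {a\<in>A. Q a} = card A" for Q
  proof -
    have "A = {a\<in>A. \<not> Q a} \<union> {a\<in>A. Q a}"
      by blast
    then show ?thesis
      using card_Un_disjoint[of "{a\<in>A. \<not> Q a}" "{a\<in>A. Q a}"] fin by fastforce
  qed
  have "card {v \<in> hamming_verts 3 A - C. hamming_adj 3 u v} = 2 * card A - \<gamma>" if uC: "u \<in> C" for u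
  proof -
    obtain s x y where u: "u = [s, x, y]" "s \<in> A" "x \<in> A" "y \<in> A" "P s x y"
      using uC unfolding C_def by blast
    have "{v \<in> hamming_verts 3 A - C. hamming_adj 3 u v} =
        {v. (\<exists>a\<in>A. \<exists>b\<in>A. \<exists>c\<in>A. v = [a, b, c] \<and> \<not> P a b c) \<and> hamming_adj 3 [s, x, y] v}"
      by (auto simp: C_def hamming_verts_3_iff u(1))
    then have "card {v \<in> hamming_verts 3 A - C. hamming_adj 3 u v} =
        card {a\<in>A. \<not> P a x y} + card {b\<in>A. \<not> P s b y} + card {c\<in>A. \<not> P s x c}"
      using card_neighbours_3[of A s x y "\<lambda>a b c. \<not> P a b c"] fin u by simp
    then show ?thesis
      using sums[of s x y] u not_card[of "\<lambda>a. P a x y"] not_card[of "\<lambda>b. P s b y"]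
        not_card[of "\<lambda>c. P s x c"] by simp
  qed
  moreover have "card {v \<in> C. hamming_adj 3 u v} = \<gamma>" if uC: "u \<in> hamming_verts 3 A - C" for u
  proof -
    obtain s x y where u: "u = [s, x, y]" "s \<in> A" "x \<in> A" "y \<in> A" "\<not> P s x y"
      using uC by (auto simp: C_def hamming_verts_3_iff)
    then have "card {v \<in> C. hamming_adj 3 u v} =
        card {a\<in>A. P a x y} + card {b\<in>A. P s b y} + card {c\<in>A. P s x c}"
      using card_neighbours_3[of A s x y P] fin by (simp add: C_def)
    then show ?thesis
      using sums[of s x y] u by simp
  qed
  moreover have "C \<subset> hamming_verts 3 A"
    using assms(6) by (auto simp: C_def hamming_verts_3_iff)
  ultimately show ?thesis
    using assms(3-5) unfolding completely_regular_code_1_def by simp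
qed

text \<open>Translation by \<open>i\<close> permutes the residues mod \<open>n\<close>, so exactly
  \<open>k\<close> of them land below \<open>k\<close>.\<close>

lemma card_mod_less:
  fixes n k i :: nat
  assumes "k \<le> n"
  shows "card {j. j < n \<and> (i + j) mod n < k} = k"
proof (cases "n = 0")
  case False
  let ?f = "\<lambda>j. (i + j) mod n" and ?J = "{j. j < n \<and> (i + j) mod n < k}"
  have inj: "inj_on ?f {..<n}"
  proof (rule inj_onI)
    fix j j' assume "j \<in> {..<n}" "j' \<in> {..<n}" "?f j = ?f j'"
    then show "j = j'"
      using cong_add_lcancel_nat[of i j j' n] by (simp add: cong_def)
  qed
  have "?f ` {..<n} = {..<n}"
    using inj False by (intro card_subset_eq) (auto simp: card_image)
  moreover have "?f ` ?J = ?f ` {..<n} \<inter> {..<k}"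
    by auto
  ultimately have "?f ` ?J = {..<k}"
    using assms by auto
  moreover have "inj_on ?f ?J"
    using inj by (rule inj_on_subset) auto
  ultimately show ?thesis
    using card_image[of ?f ?J] by simp
qed (use assms in simp)

lemma exists_regular_bipartite:
  fixes X :: "'a set"
  assumes "finite X" "k \<le> card X"
  obtains E :: "'a \<Rightarrow> 'a \<Rightarrow> bool" where
    "\<And>x. x \<in> X \<Longrightarrow> card {y\<in>X. E x y} = k" "\<And>y. y \<in> X \<Longrightarrow> card {x\<in>X. E x y} = k"
proof -
  obtain h where h: "bij_betw h X {0..<card X}"
    using ex_bij_betw_finite_nat[OF assms(1)] by blast
  \<comment> \<open>Taking the sum \<open>h x + h y\<close> makes \<open>E\<close> symmetric, so the
    degrees on one side give those on the other.\<close>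
  define E where "E x y \<longleftrightarrow> (h x + h y) mod card X < k" for x y
  have right: "card {y\<in>X. E x y} = k" for x
  proof -
    have "bij_betw h {y\<in>X. E x y} {j. j < card X \<and> (h x + j) mod card X < k}"
      unfolding bij_betw_def
    proof
      show "inj_on h {y\<in>X. E x y}"
        using h by (auto simp: bij_betw_def inj_on_def)
      have "h ` X = {0..<card X}"
        using h by (simp add: bij_betw_def)
      then show "h ` {y\<in>X. E x y} = {j. j < card X \<and> (h x + j) mod card X < k}"
        unfolding E_def by (fastforce simp: set_eq_iff)
    qed
    then show ?thesis
      using bij_betw_same_card card_mod_less[OF assms(2), of "h x"] by fastforce
  qed
  have "{x\<in>X. E x y} = {x\<in>X. E y x}" for y
    by (simp add: E_def add.commute)
  then show ?thesis
    using that[of E] right by simp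
qed

theorem theorem2:
  fixes A :: "'a set" and q \<gamma> :: nat
  assumes "finite A" and "card A = q"
    and "even q" and "q \<ge> 2"
    and "real q / 2 < real \<gamma>" and "\<gamma> < q"
  shows "\<exists>C \<beta>. completely_regular_code_1 (hamming_verts 3 A) (hamming_adj 3) C \<beta> \<gamma> \<and>
           code_eigenvalue (hamming_degree 3 q) \<beta> \<gamma> = hamming_eigenvalue 2 3 q"
proof -
  obtain m where q: "q = 2 * m"
    using assms(3) by (elim evenE)
  have \<gamma>: "m < \<gamma>" "0 < \<gamma>"
    using assms(5) q by simp_all
  obtain B where B: "B \<subseteq> A" "card B = m"
    using obtain_subset_with_card_n[of m A] assms(2) q by auto
  obtain X where X: "X \<subseteq> A" "card X = \<gamma>"
    using obtain_subset_with_card_n[of \<gamma> A] assms(2,6) by auto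
  have fin: "finite B" "finite X"
    using B X assms(1) finite_subset by auto
  \<comment> \<open>The degree d = \<gamma> - m is forced on X \<times> X: the lines in the second
    and third directions must contribute 2d + (q - \<gamma>) = \<gamma> together.\<close>
  obtain E where E: "\<And>x. x \<in> X \<Longrightarrow> card {y\<in>X. E x y} = \<gamma> - m"
      "\<And>y. y \<in> X \<Longrightarrow> card {x\<in>X. E x y} = \<gamma> - m"
    using exists_regular_bipartite[OF fin(2), of "\<gamma> - m"] X(2) by auto
  define P where "P s x y \<longleftrightarrow> x \<in> X \<and> y \<in> X \<and> E x y \<or> s \<in> B \<and> x \<notin> X \<and> y \<in> X \<or>
      s \<notin> B \<and> x \<in> X \<and> y \<notin> X" for s x y
  define C where "C = {v. \<exists>a\<in>A. \<exists>b\<in>A. \<exists>c\<in>A. v = [a, b, c] \<and> P a b c}"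
  have compl: "card (A - X) = q - \<gamma>" "card (A - B) = m"
    using B X fin assms(2) q by (simp_all add: card_Diff_subset)
  have split: "card {a\<in>A. Q a} = card {a\<in>X. Q a} + card {a\<in>A - X. Q a}" for Q
  proof -
    have "{a\<in>A. Q a} = {a\<in>X. Q a} \<union> {a\<in>A - X. Q a}"
      using X by auto
    then show ?thesis
      using assms(1) fin by (simp add: card_Un_disjoint disjoint_iff)
  qed
  \<comment> \<open>Membership in \<open>E\<close> ignores the first coordinate, so over X \<times>
    X these lines are full or empty. Where exactly one of \<open>x\<close>, \<open>y\<close> lies in
    \<open>X\<close> they are half full, as \<open>B\<close> and \<open>A - B\<close> both have size
    \<open>m\<close>.\<close>
  have line1: "card {a\<in>A. P a x y} =
      (if x \<in> X \<and> y \<in> X then if E x y then q else 0 else if x \<in> X \<or> y \<in> X then m else 0)" for x y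
  proof -
    have "{a\<in>A. P a x y} = (if x \<in> X \<and> y \<in> X then if E x y then A else {}
        else if x \<in> X then A - B else if y \<in> X then B else {})"
      using B by (auto simp: P_def)
    then show ?thesis
      using compl B assms(2) by simp
  qed
  have line2: "card {b\<in>A. P s b y} =
      (if y \<in> X then \<gamma> - m + (if s \<in> B then q - \<gamma> else 0) else if s \<in> B then 0 else \<gamma>)" for s y
  proof -
    have "{b\<in>X. P s b y} = (if y \<in> X then {b\<in>X. E b y} else if s \<in> B then {} else X)"
      "{b\<in>A - X. P s b y} = (if y \<in> X \<and> s \<in> B then A - X else {})"
      by (auto simp: P_def)
    then show ?thesis
      using split[of "\<lambda>b. P s b y"] E compl X by simp
  qed
  have line3: "card {c\<in>A. P s x c} =
      (if x \<in> X then \<gamma> - m + (if s \<in> B then 0 else q - \<gamma>) else if s \<in> B then \<gamma> else 0)" for s x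
  proof -
    have "{c\<in>X. P s x c} = (if x \<in> X then {c\<in>X. E x c} else if s \<in> B then X else {})"
      "{c\<in>A - X. P s x c} = (if x \<in> X \<and> s \<notin> B then A - X else {})"
      by (auto simp: P_def)
    then show ?thesis
      using split[of "\<lambda>c. P s x c"] E compl X by simp
  qed
  \<comment> \<open>For x outside and y inside \<open>X\<close>, for instance, the sum is m + (q -
    m) + \<gamma> if s \<in> B and m + (\<gamma> - m) + 0 otherwise.\<close>
  have sums: "card {a\<in>A. P a x y} + card {b\<in>A. P s b y} + card {c\<in>A. P s x c}
      = (if P s x y then card A else 0) + \<gamma>" for s x y
    unfolding line1 line2 line3 using \<gamma> assms(2,6) q by (auto simp: P_def)
  obtain z where z: "z \<in> A" "z \<notin> X"
    using X assms(2,6) by (metis order.strict_implies_not_eq subsetI subset_antisym)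
  obtain x where x: "x \<in> X"
    using X \<gamma> by fastforce
  \<comment> \<open>Which of the two triples lies in \<open>C\<close> depends on whether z \<in> B;
    no triple with both last entries outside \<open>X\<close> does.\<close>
  have "[z, z, x] \<in> C \<or> [z, x, z] \<in> C" "[z, z, z] \<in> hamming_verts 3 A" "[z, z, z] \<notin> C"
    using z x X by (auto simp: C_def P_def hamming_verts_3_iff)
  then have "C \<noteq> {}" "C \<noteq> hamming_verts 3 A"
    by auto
  then have "completely_regular_code_1 (hamming_verts 3 A) (hamming_adj 3) C (2 * q - \<gamma>) \<gamma>"
    using completely_regular_code_1_by_line_sums[of A \<gamma> P] assms(1,2,6) \<gamma> sums
    by (simp add: C_def)
  moreover have "code_eigenvalue (hamming_degree 3 q) (2 * q - \<gamma>) \<gamma> = hamming_eigenvalue 2 3 q"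
    using assms(6) by (simp add: code_eigenvalue_def hamming_eigenvalue_def)
  ultimately show ?thesis
    by blast
qed

end
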